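(* For $n\geq2$, define the parent map $p(\alpha_1,\ldots,\alpha_{n+1})=(\alpha_1,\ldots,\alpha_n)$. Then $p$ maps $\mathcal{A}_n$ into $\mathcal{A}_{n-1}$, and every element of $\mathcal{A}_n$ has a unique parent. If $\boldsymbol{\alpha}=(\alpha_1,\ldots,\alpha_n)\in\mathcal{A}_{n-1}$, its children (the elements of $\mathcal{A}_n$ mapped to $\boldsymbol{\alpha}$ by $p$) are precisely $$(\alpha_1,\ldots,\alpha_n,j),\qquad \alpha_n<j\leq\kappa(n).$$ Consequently, the disjoint union $\bigsqcup_{n\geq1}\mathcal{A}_n$, with edges from parents to children, is a directed rooted tree with root $(0,1)$. Its binary realization (via $\boldsymbol{\alpha}\mapsto v(\boldsymbol{\alpha})$ on each level) is the tree $\bigsqcup_{n\geq1}\mathbb{V}(n)$ with root $(1~1)$. The tree has no leaves: every node has at least one child, and every finite branch can be extended.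
   Context: For $n\ge1$ let $\kappa(n)=\lfloor n\log_2 3\rfloor$. For $n\ge1$ let $\mathcal{A}_n$ be the set of integer vectors $(\alpha_1,\ldots,\alpha_{n+1})$ with $0=\alpha_1<\alpha_2<\cdots<\alpha_{n+1}$ and $\alpha_{i+1}\le\kappa(i)$ for $1\le i\le n$ (so $\mathcal{A}_1=\{(0,1)\}$). For $\boldsymbol{\alpha}\in\mathcal{A}_n$ let $v(\boldsymbol{\alpha})\in\{0,1\}^{\kappa(n)+1}$ be the vector, with positions indexed $0,\ldots,\kappa(n)$, whose entries equal $1$ precisely at the positions $\alpha_1,\ldots,\alpha_{n+1}$, and let $\mathbb{V}(n)=\{v(\boldsymbol{\alpha}):\boldsymbol{\alpha}\in\mathcal{A}_n\}$. *)

theory Defs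
  imports Complex_Main "Graph_Theory.Graph_Theory"
begin

definition kappa :: "nat \<Rightarrow> int" where
  "kappa n = \<lfloor>real n * log 2 3\<rfloor>"

text \<open>
  A vector $(\alpha_1,\ldots,\alpha_{n+1})$ is a list of length $n+1$. List positions start
  at $0$, so $\alpha_{i+1}$ is \<open>\<alpha> ! i\<close>.
\<close>

definition A :: "nat \<Rightarrow> int list set" where
  "A n = {\<alpha>. length \<alpha> = n + 1 \<and> \<alpha> ! 0 = 0 \<and> sorted_wrt (<) \<alpha>
               \<and> (\<forall>i\<in>{1..n}. \<alpha> ! i \<le> kappa i)}"

definition bin_vec :: "nat \<Rightarrow> int list \<Rightarrow> nat list" where
  "bin_vec n \<alpha> = map (\<lambda>k. if int k \<in> set \<alpha> then 1 else 0) [0..<nat (kappa n) + 1]"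

definition V :: "nat \<Rightarrow> nat list set" where
  "V n = bin_vec n ` A n"

definition parent :: "int list \<Rightarrow> int list" where
  "parent \<alpha> = butlast \<alpha>"

definition children :: "nat \<Rightarrow> int list \<Rightarrow> int list set" where
  "children n \<alpha> = {\<beta> \<in> A n. parent \<beta> = \<alpha>}"

text \<open>
  Disjoint unions over the levels are sets of pairs (level, vector). An arc is the pair
  of its end points, tail first.
\<close>

definition A_tree :: "(nat \<times> int list, (nat \<times> int list) \<times> (nat \<times> int list)) pre_digraph" where
  "A_tree = \<lparr> verts = (SIGMA n:{1..}. A n),
              arcs = {((n - 1, \<alpha>), (n, \<beta>)) | n \<alpha> \<beta>. 2 \<le> n \<and> \<alpha> \<in> A (n - 1) \<and> \<beta> \<in> children n \<alpha>},
              tail = fst, head = snd \<rparr>"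

definition realize_vert :: "nat \<times> int list \<Rightarrow> nat \<times> nat list" where
  "realize_vert = (\<lambda>(n, \<alpha>). (n, bin_vec n \<alpha>))"

definition realization ::
  "(nat \<times> int list, (nat \<times> int list) \<times> (nat \<times> int list),
    nat \<times> nat list, (nat \<times> nat list) \<times> (nat \<times> nat list)) digraph_isomorphism" where
  "realization = \<lparr> iso_verts = realize_vert, iso_arcs = map_prod realize_vert realize_vert,
                   iso_head = snd, iso_tail = fst \<rparr>"

text \<open>
  The binary realization is the image digraph; that the map onto it is an isomorphism is
  not part of this definition.
\<close>

definition V_tree :: "(nat \<times> nat list, (nat \<times> nat list) \<times> (nat \<times> nat list)) pre_digraph" where
  "V_tree = app_iso realization A_tree"

text \<open>
  A directed rooted tree (out-arborescence), possibly infinite. Uniqueness of the walk for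
  the root itself excludes cycles through the root.
\<close>

definition directed_rooted_tree :: "('a, 'b) pre_digraph \<Rightarrow> 'a \<Rightarrow> bool" where
  "directed_rooted_tree G r \<longleftrightarrow>
     wf_digraph G \<and> r \<in> verts G \<and> (\<forall>u \<in> verts G. \<exists>!p. pre_digraph.awalk G r p u)"

definition no_leaves :: "('a, 'b) pre_digraph \<Rightarrow> bool" where
  "no_leaves G \<longleftrightarrow> (\<forall>u \<in> verts G. \<exists>w \<in> verts G. u \<rightarrow>\<^bsub>G\<^esub> w)"

text \<open>A finite branch is a finite directed path that starts at the root.\<close>

definition finite_branches_extend :: "('a, 'b) pre_digraph \<Rightarrow> 'a \<Rightarrow> bool" where
  "finite_branches_extend G r \<longleftrightarrow>
     (\<forall>p u. pre_digraph.apath G r p u \<longrightarrow> (\<exists>e w. pre_digraph.apath G r (p @ [e]) w))"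

end

theory Submission
  imports Defs
begin

text \<open>
  Appending \<open>j\<close> to an element \<open>\<alpha>\<close> of level \<open>n\<close> gives an element of level \<open>n + 1\<close> if and
  only if \<open>last \<alpha> < j \<le> kappa (n + 1)\<close>, and every element of level \<open>n + 1\<close> arises in this
  way from exactly one \<open>\<alpha>\<close>, its list without the last entry (\<open>snoc_in_A_iff\<close>,
  \<open>A_Suc_eq\<close>). The claims on parents and children rest on this. As \<open>log 2 3 > 1\<close>, the
  sequence \<open>kappa\<close> increases strictly, so \<open>j = kappa (n + 1)\<close> is always a legal choice:
  there are no leaves.

  Each vertex other than \<open>(1, [0, 1])\<close> thus has exactly one incoming arc, and the level
  drops when the arc is followed backwards. Walking backwards is therefore deterministic
  and stops, and it can stop only at the root. This gives one and only one walk from the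
  root to each vertex (\<open>directed_rooted_treeI_rank\<close>). Once there is a tree without leaves,
  extending branches is a general fact: a walk from the root never meets a vertex twice,
  because cutting out the loop would give a second walk to its end point
  (\<open>finite_branches_extendI\<close>).

  An increasing list is determined by its set of entries, and those entries are the
  positions of the ones in its binary vector. So the realization is injective, hence an
  isomorphism of digraphs, and everything carries over to the binary tree.
\<close>

section \<open>Rooted trees as digraphs with unique walks\<close>

text \<open>
  The rank makes backward walks finite, so induction on the rank of the end point
  applies: the last arc of a walk from \<open>r\<close> to \<open>u \<noteq> r\<close> is forced, and what precedes it is
  a walk to a vertex of smaller rank.
\<close>

lemma directed_rooted_treeI_rank:
  fixes rank :: "'a \<Rightarrow> nat"
  assumes wf: "wf_digraph G" and root: "r \<in> verts G"
    and no_arc_into_root: "in_arcs G r = {}"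
    and unique_in_arc: "\<And>u. u \<in> verts G \<Longrightarrow> u \<noteq> r \<Longrightarrow> \<exists>e. in_arcs G u = {e}"
    and rank_less: "\<And>e. e \<in> arcs G \<Longrightarrow> rank (tail G e) < rank (head G e)"
  shows "directed_rooted_tree G r"
proof -
  interpret wf_digraph G by (fact wf)
  have last_in_arc: "last p \<in> in_arcs G u" and butlast_walk: "awalk r (butlast p) (tail G (last p))"
    if "awalk r p u" "p \<noteq> []" for p u
  proof -
    have "awalk r (butlast p @ [last p]) u"
      using that by simp
    then show "last p \<in> in_arcs G u" "awalk r (butlast p) (tail G (last p))"
      unfolding awalk_append_iff by (auto simp: awalk_simps in_arcs_def)
  qed
  have "\<exists>!p. awalk r p u" if "u \<in> verts G" for u
    using that
  proof (induction "rank u" arbitrary: u rule: less_induct)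
    case less
    show ?case
    proof (cases "u = r")
      case True
      have "p = []" if "awalk r p u" for p
        using last_in_arc[OF that] no_arc_into_root True by auto
      moreover have "awalk r [] u"
        using root True by (simp add: awalk_Nil_iff)
      ultimately show ?thesis by blast
    next
      case False
      then obtain e where e: "in_arcs G u = {e}"
        using unique_in_arc less.prems by blast
      then have "e \<in> arcs G" and [simp]: "head G e = u"
        by (auto simp: in_arcs_def)
      then have "\<exists>!p. awalk r p (tail G e)"
        using less.hyps[of "tail G e"] rank_less[of e] by simp
      then obtain p where p: "awalk r p (tail G e)"
        and p_unique: "\<And>q. awalk r q (tail G e) \<Longrightarrow> q = p"
        by blast
      have "awalk r (p @ [e]) u"
        using p \<open>e \<in> arcs G\<close> arc_implies_awalk[of e] by (intro awalk_appendI) auto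
      moreover have "q = p @ [e]" if q: "awalk r q u" for q
      proof -
        have "q \<noteq> []"
          using q False by (auto simp: awalk_Nil_iff)
        moreover have "last q = e"
          using last_in_arc[OF q \<open>q \<noteq> []\<close>] e by simp
        moreover have "butlast q = p"
          using butlast_walk[OF q \<open>q \<noteq> []\<close>] \<open>last q = e\<close> p_unique by simp
        ultimately show ?thesis
          by (metis append_butlast_last_id)
      qed
      ultimately show ?thesis by blast
    qed
  qed
  then show ?thesis
    using wf root by (simp add: directed_rooted_tree_def)
qed

text \<open>
  A repeated vertex would split off a nonempty closed part of the walk; the walk with
  this part removed has the same ends but a smaller length.
\<close>

lemma directed_rooted_tree_walk_is_path:
  assumes tree: "directed_rooted_tree G r" and walk: "pre_digraph.awalk G r p u"
  shows "pre_digraph.apath G r p u"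
proof -
  interpret wf_digraph G
    using tree by (simp add: directed_rooted_tree_def)
  have "distinct (awalk_verts r p)"
  proof (rule ccontr)
    assume "\<not> distinct (awalk_verts r p)"
    then obtain q c s w where p: "p = q @ c @ s" "0 < length c"
      and "awalk r q w" "awalk w s u"
      using awalk_not_distinct_decomp[OF walk] by blast
    then have "awalk r (q @ s) u"
      using awalk_appendI by blast
    moreover have "q @ s \<noteq> p"
      using p by simp
    moreover have "u \<in> verts G"
      using walk by (rule awalk_last_in_verts)
    ultimately show False
      using tree walk unfolding directed_rooted_tree_def by blast
  qed
  then show ?thesis
    using walk by (simp add: apath_def)
qed

lemma finite_branches_extendI:
  assumes tree: "directed_rooted_tree G r" and "no_leaves G"
  shows "finite_branches_extend G r"
  unfolding finite_branches_extend_def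
proof (intro allI impI)
  interpret wf_digraph G
    using tree by (simp add: directed_rooted_tree_def)
  fix p u assume "apath r p u"
  then have walk: "awalk r p u"
    by (rule awalkI_apath)
  then have "u \<in> verts G"
    by (rule awalk_last_in_verts)
  then obtain e where "e \<in> arcs G" "tail G e = u"
    using \<open>no_leaves G\<close> by (fastforce simp: no_leaves_def)
  then have "awalk r (p @ [e]) (head G e)"
    using walk arc_implies_awalk[of e] by (intro awalk_appendI) auto
  then show "\<exists>e w. apath r (p @ [e]) w"
    using directed_rooted_tree_walk_is_path[OF tree] by blast
qed

text \<open>Existence of walks goes through the isomorphism, uniqueness through its inverse.\<close>

lemma directed_rooted_tree_app_iso:
  assumes tree: "directed_rooted_tree G r" and iso: "pre_digraph.digraph_isomorphism G hom"
  shows "directed_rooted_tree (app_iso hom G) (iso_verts hom r)"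
proof -
  interpret wf_digraph G
    using tree by (simp add: directed_rooted_tree_def)
  interpret H: wf_digraph "app_iso hom G"
    using iso ..
  have root: "r \<in> verts G" and walks: "\<And>u. u \<in> verts G \<Longrightarrow> \<exists>!p. awalk r p u"
    using tree by (auto simp: directed_rooted_tree_def)
  have "\<exists>!p. H.awalk (iso_verts hom r) p (iso_verts hom u)" if u: "u \<in> verts G" for u
  proof -
    obtain p where p: "awalk r p u" and p_unique: "\<And>q. awalk r q u \<Longrightarrow> q = p"
      using walks[OF u] by blast
    have "q = map (iso_arcs hom) p" if q: "H.awalk (iso_verts hom r) q (iso_verts hom u)" for q
    proof -
      have "map (iso_arcs (inv_iso hom)) q = p"
        using awalk_app_isoD[OF q iso] p_unique iso root u by simp
      moreover have "set q \<subseteq> arcs (app_iso hom G)"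
        using q by (simp add: H.awalk_def)
      then have "map (iso_arcs hom) (map (iso_arcs (inv_iso hom)) q) = q"
        using iso iso_arcs_iso_inv[OF iso] by (simp add: map_idI subset_iff)
      ultimately show ?thesis by simp
    qed
    then show ?thesis
      using awalk_app_isoI[OF p iso] by blast
  qed
  then show ?thesis
    using root H.wf_digraph by (auto simp: directed_rooted_tree_def)
qed

lemma no_leaves_app_iso:
  assumes "no_leaves G" and iso: "pre_digraph.digraph_isomorphism G hom"
  shows "no_leaves (app_iso hom G)"
proof -
  interpret wf_digraph G
    using iso by (simp add: pre_digraph.digraph_isomorphism_def)
  show ?thesis
    using \<open>no_leaves G\<close> by (fastforce simp: no_leaves_def arcs_ends_app_iso_eq[OF iso])
qed

section \<open>Parents and children\<close>

lemma kappa_0: "kappa 0 = 0"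
  by (simp add: kappa_def)

lemma log_2_3_bounds: "1 < log 2 (3::real)" "log 2 (3::real) < 2"
  by (simp_all add: less_log_iff log_less_iff)

lemma kappa_1: "kappa 1 = 1"
  using log_2_3_bounds by (simp add: kappa_def floor_eq_iff)

lemma kappa_less_Suc: "kappa n < kappa (Suc n)"
proof -
  have "real n * log 2 3 + 1 \<le> real (Suc n) * log 2 3"
    using log_2_3_bounds by (simp add: algebra_simps)
  then have "\<lfloor>real n * log 2 3 + 1\<rfloor> \<le> kappa (Suc n)"
    unfolding kappa_def by (rule floor_mono)
  then show ?thesis
    by (simp add: kappa_def)
qed

lemma mono_kappa: "mono kappa"
  by (simp add: incseq_SucI kappa_less_Suc less_imp_le)

lemma last_le_kappa:
  assumes "\<alpha> \<in> A n"
  shows "last \<alpha> \<le> kappa n"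
proof -
  have "last \<alpha> = \<alpha> ! n"
    using assms by (subst last_conv_nth) (auto simp: A_def)
  then show ?thesis
    using assms by (cases "n = 0") (auto simp: A_def kappa_0)
qed

lemma snoc_in_A_iff:
  "\<alpha> @ [j] \<in> A (Suc n) \<longleftrightarrow> \<alpha> \<in> A n \<and> last \<alpha> < j \<and> j \<le> kappa (Suc n)"
proof (cases "length \<alpha> = Suc n")
  case True
  then have "\<alpha> \<noteq> []"
    by auto
  \<comment> \<open>In an increasing list only the last entry has to be compared with the new one.\<close>
  have "(\<forall>x\<in>set \<alpha>. x < j) \<longleftrightarrow> last \<alpha> < j" if "sorted_wrt (<) \<alpha>"
  proof -
    have "sorted_wrt (<) (butlast \<alpha> @ [last \<alpha>])"
      using that \<open>\<alpha> \<noteq> []\<close> by simp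
    then have "\<forall>x\<in>set (butlast \<alpha>). x < last \<alpha>"
      by (simp add: sorted_wrt_append)
    moreover have "set \<alpha> = insert (last \<alpha>) (set (butlast \<alpha>))"
      using \<open>\<alpha> \<noteq> []\<close> by (metis append_butlast_last_id list.set(1,2) set_append Un_insert_right sup_bot_right)
    ultimately show ?thesis by auto
  qed
  moreover have "(\<forall>i\<in>{1..Suc n}. (\<alpha> @ [j]) ! i \<le> kappa i) \<longleftrightarrow>
      (\<forall>i\<in>{1..n}. \<alpha> ! i \<le> kappa i) \<and> j \<le> kappa (Suc n)"
    using True by (auto simp: atLeastAtMostSuc_conv nth_append)
  ultimately show ?thesis
    using True \<open>\<alpha> \<noteq> []\<close> by (auto simp: A_def nth_append sorted_wrt_append)
qed (auto simp: A_def)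

lemma A_Suc_eq:
  "A (Suc n) = {\<alpha> @ [j] | \<alpha> j. \<alpha> \<in> A n \<and> last \<alpha> < j \<and> j \<le> kappa (Suc n)}"
proof -
  have "\<exists>\<alpha> j. \<beta> = \<alpha> @ [j]" if "\<beta> \<in> A (Suc n)" for \<beta>
    using that by (cases \<beta> rule: rev_cases) (auto simp: A_def)
  then show ?thesis
    by (fastforce simp: snoc_in_A_iff)
qed

lemma A_0: "A 0 = {[0]}"
  by (auto simp: A_def length_Suc_conv)

lemma A_1: "A 1 = {[0, 1]}"
proof -
  have "A (Suc 0) = {[0, j] | j. 0 < j \<and> j \<le> 1}"
    using kappa_1 by (auto simp: A_Suc_eq A_0)
  also have "\<dots> = {[0, 1]}"
    by auto
  finally show ?thesis by simp
qed

lemma parent_in_A: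
  assumes "\<beta> \<in> A (Suc n)"
  shows "parent \<beta> \<in> A n"
  using assms by (auto simp: A_Suc_eq parent_def)

lemma children_Suc_eq:
  assumes "\<alpha> \<in> A n"
  shows "children (Suc n) \<alpha> = {\<alpha> @ [j] | j. last \<alpha> < j \<and> j \<le> kappa (Suc n)}"
  using assms by (auto simp: children_def A_Suc_eq parent_def)

section \<open>The tree of integer vectors\<close>

text \<open>
  The level \<open>n\<close> of the child in the definition of the arcs starts at 2; counting with the
  level of the parent instead removes the subtraction.
\<close>

lemma A_tree_arc_iff:
  "e \<in> arcs A_tree \<longleftrightarrow>
    (\<exists>n \<beta>. 1 \<le> n \<and> \<beta> \<in> A (Suc n) \<and> e = ((n, parent \<beta>), (Suc n, \<beta>)))"
proof
  assume "e \<in> arcs A_tree"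
  then obtain n \<beta> where "2 \<le> n" "\<beta> \<in> A n" "e = ((n - 1, parent \<beta>), (n, \<beta>))"
    by (auto simp: A_tree_def children_def)
  then show "\<exists>n \<beta>. 1 \<le> n \<and> \<beta> \<in> A (Suc n) \<and> e = ((n, parent \<beta>), (Suc n, \<beta>))"
    by (intro exI[of _ "n - 1"] exI[of _ \<beta>]) auto
next
  assume "\<exists>n \<beta>. 1 \<le> n \<and> \<beta> \<in> A (Suc n) \<and> e = ((n, parent \<beta>), (Suc n, \<beta>))"
  then obtain n \<beta> where "1 \<le> n" "\<beta> \<in> A (Suc n)" "e = ((n, parent \<beta>), (Suc n, \<beta>))"
    by blast
  moreover from this have "parent \<beta> \<in> A n"
    by (simp add: parent_in_A)
  ultimately show "e \<in> arcs A_tree"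
    by (auto simp: A_tree_def children_def intro!: exI[of _ "Suc n"])
qed

lemma A_tree_verts_iff: "(n, \<alpha>) \<in> verts A_tree \<longleftrightarrow> 1 \<le> n \<and> \<alpha> \<in> A n"
  by (auto simp: A_tree_def)

lemma A_tree_tail: "tail A_tree = fst" and A_tree_head: "head A_tree = snd"
  by (simp_all add: A_tree_def)

lemma wf_digraph_A_tree: "wf_digraph A_tree"
  by unfold_locales
    (auto simp: A_tree_arc_iff A_tree_tail A_tree_head A_tree_verts_iff parent_in_A)

lemma directed_rooted_tree_A_tree: "directed_rooted_tree A_tree (1, [0, 1])"
proof (rule directed_rooted_treeI_rank[where rank = fst])
  show "wf_digraph A_tree"
    by (rule wf_digraph_A_tree)
  show "(1, [0, 1]) \<in> verts A_tree"
    unfolding A_tree_verts_iff A_1 by simp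
  show "in_arcs A_tree (1, [0, 1]) = {}"
    by (auto simp: in_arcs_def A_tree_head A_tree_arc_iff)
  show "\<exists>e. in_arcs A_tree u = {e}" if u: "u \<in> verts A_tree" "u \<noteq> (1, [0, 1])" for u
  proof -
    obtain n \<beta> where n\<beta>: "u = (n, \<beta>)"
      by fastforce
    then have "1 \<le> n" "\<beta> \<in> A n"
      using u by (auto simp: A_tree_verts_iff)
    moreover have "n \<noteq> 1"
      using calculation(2) A_1 u n\<beta> by auto
    ultimately obtain m where "n = Suc m" "1 \<le> m"
      by (cases n) auto
    then have "in_arcs A_tree u = {((m, parent \<beta>), u)}"
      using n\<beta> \<open>\<beta> \<in> A n\<close> by (auto simp: in_arcs_def A_tree_head A_tree_arc_iff)
    then show ?thesis ..
  qed
  show "fst (tail A_tree e) < fst (head A_tree e)" if "e \<in> arcs A_tree" for e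
    using that by (auto simp: A_tree_arc_iff A_tree_tail A_tree_head)
qed

lemma no_leaves_A_tree: "no_leaves A_tree"
  unfolding no_leaves_def
proof
  fix u assume "u \<in> verts A_tree"
  then obtain n \<alpha> where u: "u = (n, \<alpha>)" and n: "1 \<le> n" and \<alpha>: "\<alpha> \<in> A n"
    by (cases u) (auto simp: A_tree_verts_iff)
  \<comment> \<open>The largest value allowed at the next level always exceeds the last entry.\<close>
  let ?\<beta> = "\<alpha> @ [kappa (Suc n)]"
  have \<beta>: "?\<beta> \<in> A (Suc n)"
    using \<alpha> last_le_kappa[OF \<alpha>] kappa_less_Suc[of n] by (simp add: snoc_in_A_iff)
  then have "(u, (Suc n, ?\<beta>)) \<in> arcs A_tree"
    using n u by (auto simp: A_tree_arc_iff parent_def)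
  then have "(u, (Suc n, ?\<beta>)) \<in> arcs_ends A_tree"
    by (force simp: arcs_ends_conv A_tree_tail A_tree_head)
  moreover have "(Suc n, ?\<beta>) \<in> verts A_tree"
    using \<beta> by (simp add: A_tree_verts_iff)
  ultimately show "\<exists>w\<in>verts A_tree. u \<rightarrow>\<^bsub>A_tree\<^esub> w"
    by blast
qed

section \<open>The binary realization\<close>

lemma A_entries_bounded:
  assumes "\<alpha> \<in> A n" "x \<in> set \<alpha>"
  shows "0 \<le> x \<and> x \<le> kappa n"
proof -
  obtain i where i: "i \<le> n" "x = \<alpha> ! i"
    using assms by (auto simp: A_def in_set_conv_nth less_Suc_eq_le)
  have "0 \<le> \<alpha> ! i"
    using assms(1) i(1) by (cases "i = 0") (auto simp: A_def sorted_wrt_iff_nth_less less_imp_le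
        dest: spec[of _ 0])
  moreover have "\<alpha> ! i \<le> kappa i"
    using assms(1) i(1) by (cases "i = 0") (auto simp: A_def kappa_0)
  moreover have "kappa i \<le> kappa n"
    using mono_kappa i(1) by (rule monoD)
  ultimately show ?thesis
    using i(2) by simp
qed

text \<open>
  The binary vector ends at position \<open>kappa n\<close>; the bound on the entries ensures that none
  of them is cut off.
\<close>

lemma set_eq_ones_of_bin_vec:
  assumes "\<alpha> \<in> A n"
  shows "set \<alpha> = int ` {k. k < length (bin_vec n \<alpha>) \<and> bin_vec n \<alpha> ! k = 1}"
proof -
  have "{k. k < length (bin_vec n \<alpha>) \<and> bin_vec n \<alpha> ! k = 1}
      = {k. k < nat (kappa n) + 1 \<and> int k \<in> set \<alpha>}"
    unfolding bin_vec_def by (auto simp: nth_map_upt simp del: upt_Suc split: if_splits)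
  moreover have "x \<in> int ` {k. k < nat (kappa n) + 1 \<and> int k \<in> set \<alpha>}" if "x \<in> set \<alpha>" for x
    using A_entries_bounded[OF assms that] that by (intro image_eqI[of _ _ "nat x"]) auto
  ultimately show ?thesis by auto
qed

lemma inj_on_bin_vec: "inj_on (bin_vec n) (A n)"
proof (rule inj_onI)
  fix \<alpha> \<beta> assume \<alpha>\<beta>: "\<alpha> \<in> A n" "\<beta> \<in> A n" "bin_vec n \<alpha> = bin_vec n \<beta>"
  then have "set \<alpha> = set \<beta>"
    by (simp add: set_eq_ones_of_bin_vec)
  moreover have "sorted_wrt (<) \<alpha>" "sorted_wrt (<) \<beta>"
    using \<alpha>\<beta> by (auto simp: A_def)
  ultimately show "\<alpha> = \<beta>"
    by (simp add: strict_sorted_equal)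
qed

lemma digraph_isomorphism_realization: "pre_digraph.digraph_isomorphism A_tree realization"
proof -
  interpret wf_digraph A_tree
    by (rule wf_digraph_A_tree)
  have inj: "inj_on realize_vert (verts A_tree)"
    by (auto simp: inj_on_def realize_vert_def A_tree_verts_iff dest: inj_onD[OF inj_on_bin_vec])
  have "arcs A_tree \<subseteq> verts A_tree \<times> verts A_tree"
    using tail_in_verts head_in_verts by (auto simp: A_tree_tail A_tree_head)
  then have "inj_on (map_prod realize_vert realize_vert) (arcs A_tree)"
    using map_prod_inj_on[OF inj inj] by (rule inj_on_subset[rotated])
  with inj show ?thesis
    by (simp add: digraph_isomorphism_def wf_digraph_A_tree realization_def A_tree_tail A_tree_head)
qed

lemma verts_V_tree: "verts V_tree = (SIGMA n:{1..}. V n)"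
  by (force simp: V_tree_def realization_def realize_vert_def A_tree_def V_def)

lemma realize_root: "realize_vert (1, [0, 1]) = (1, [1, 1])"
  using kappa_1 by (simp add: realize_vert_def bin_vec_def)

lemma directed_rooted_tree_V_tree: "directed_rooted_tree V_tree (1, [1, 1])"
  using directed_rooted_tree_app_iso[OF directed_rooted_tree_A_tree digraph_isomorphism_realization]
    realize_root
  by (simp add: V_tree_def realization_def)

lemma no_leaves_V_tree: "no_leaves V_tree"
  unfolding V_tree_def
  by (rule no_leaves_app_iso[OF no_leaves_A_tree digraph_isomorphism_realization])

section \<open>Structure of the tree and of its realization\<close>

theorem theorem16:
  shows "(\<forall>n\<ge>2. parent ` A n \<subseteq> A (n - 1))
    \<and> (\<forall>n\<ge>2. \<forall>\<beta>\<in>A n. \<exists>!\<alpha>. \<alpha> \<in> A (n - 1) \<and> \<beta> \<in> children n \<alpha>)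
    \<and> (\<forall>n\<ge>2. \<forall>\<alpha>\<in>A (n - 1). children n \<alpha> = {\<alpha> @ [j] | j. last \<alpha> < j \<and> j \<le> kappa n})
    \<and> directed_rooted_tree A_tree (1, [0, 1])
    \<and> pre_digraph.digraph_isomorphism A_tree realization
    \<and> verts V_tree = (SIGMA n:{1..}. V n)
    \<and> realize_vert (1, [0, 1]) = (1, [1, 1])
    \<and> directed_rooted_tree V_tree (1, [1, 1])
    \<and> no_leaves A_tree \<and> finite_branches_extend A_tree (1, [0, 1])
    \<and> no_leaves V_tree \<and> finite_branches_extend V_tree (1, [1, 1])"
proof -
  have pred: "\<exists>m. n = Suc m" if "2 \<le> n" for n :: nat
    using that by (cases n) auto
  have "\<forall>n\<ge>2. parent ` A n \<subseteq> A (n - 1)"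
    using pred parent_in_A by fastforce
  moreover have "\<forall>n\<ge>2. \<forall>\<beta>\<in>A n. \<exists>!\<alpha>. \<alpha> \<in> A (n - 1) \<and> \<beta> \<in> children n \<alpha>"
    using pred parent_in_A by (fastforce simp: children_def)
  moreover have "\<forall>n\<ge>2. \<forall>\<alpha>\<in>A (n - 1). children n \<alpha> = {\<alpha> @ [j] | j. last \<alpha> < j \<and> j \<le> kappa n}"
    using pred children_Suc_eq by fastforce
  ultimately show ?thesis
    using directed_rooted_tree_A_tree digraph_isomorphism_realization verts_V_tree realize_root
      directed_rooted_tree_V_tree no_leaves_A_tree no_leaves_V_tree
      finite_branches_extendI[OF directed_rooted_tree_A_tree no_leaves_A_tree]
      finite_branches_extendI[OF directed_rooted_tree_V_tree no_leaves_V_tree]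
    by (intro conjI) assumption+
qed

end
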